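(* There is $\varepsilon_0 > 0$ such that for every $0<\varepsilon < \varepsilon_0$ there is $n_0(\varepsilon)$ such that for all $n > n_0(\varepsilon)$ the following holds. Let $t\ge1$ be an integer with $n^{1-\varepsilon/3} \le t \le n- 2$, and let $\mathcal{F}\subset \mathcal{T}_n$ be $t$-intersecting. Put $t'= t-n^{1-\varepsilon/3}$ and $q' = \min\{(1 + \varepsilon)t, n-1\}$. Then there exist a $t'$-intersecting family $\mathcal S$ of forests in $K_n$, each with at most $q'$ edges, and a family $\mathcal{F}'$ such that: (i) $\mathcal{F}\setminus \mathcal{F}'\subset \mathcal{T}_n[\mathcal{S}]$; (ii) for every $B\in \mathcal{S}$ there is a family $\mathcal{F}_B\subset \mathcal{F}$ such that $\mathcal{F}_B(B)$ is $n^{\varepsilon/2}$-spread; (iii) $|\mathcal{F}'|\le n^{-\frac 13\varepsilon t}\cdot c_{n, t}\,n^{n-t-2}$.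
   Context: $\mathcal{T}_n$ is the set of labelled spanning trees of $K_n$ on $[n]$; all graphs are regarded as sets of edges of $K_n$, so the ground set is $\binom{[n]}{2}$. A family of edge sets is $s$-intersecting (for real $s$) if any two of its members share at least $s$ edges. For a family $\mathcal{G}$ and a set $X$: $\mathcal{G}(X) = \{A\setminus X: A\in\mathcal{G}, X\subset A\}$, $\mathcal{G}[X]=\{A\in\mathcal{G}: X\subset A\}$, and for a family $\mathcal{S}$, $\mathcal{G}[\mathcal{S}]=\bigcup_{X\in\mathcal{S}}\mathcal{G}[X]$. For $r>1$, a family $\mathcal{G}$ of edge sets is $r$-spread if $|\mathcal{G}(Y)|<r^{-|Y|}|\mathcal{G}|$ for every nonempty set of edges $Y$. $c_{n,t}$ is the largest product of $n-t$ positive integers with sum $n$. *)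

theory Defs
  imports Complex_Main
begin

text \<open>Graphs on the vertex set \<open>{1..n}\<close> are identified with their edge sets, an edge
  being a two-element set of vertices.\<close>

definition Kn_edges :: "nat \<Rightarrow> nat set set" where
  "Kn_edges n = {e. e \<subseteq> {1..n} \<and> card e = 2}"

definition graph_cycle :: "nat set set \<Rightarrow> nat list \<Rightarrow> bool" where
  "graph_cycle E vs \<longleftrightarrow> 3 \<le> length vs \<and> distinct vs \<and>
     (\<forall>i < length vs. {vs ! i, vs ! (Suc i mod length vs)} \<in> E)"

definition Kn_forests :: "nat \<Rightarrow> nat set set set" where
  "Kn_forests n = {E. E \<subseteq> Kn_edges n \<and> \<not> (\<exists>vs. graph_cycle E vs)}"

definition edges_connect :: "nat set set \<Rightarrow> nat set \<Rightarrow> bool" where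
  "edges_connect E V \<longleftrightarrow> (\<forall>u\<in>V. \<forall>v\<in>V. (u, v) \<in> {(x, y). {x, y} \<in> E}\<^sup>*)"

definition spanning_trees :: "nat \<Rightarrow> nat set set set" where
  "spanning_trees n = {E \<in> Kn_forests n. edges_connect E {1..n}}"

text \<open>The two members may coincide, so every member of an \<open>s\<close>-intersecting family has at
  least \<open>s\<close> elements.\<close>

definition intersecting :: "real \<Rightarrow> 'a set set \<Rightarrow> bool" where
  "intersecting s \<G> \<longleftrightarrow> (\<forall>A\<in>\<G>. \<forall>B\<in>\<G>. s \<le> real (card (A \<inter> B)))"

definition fam_link :: "'a set set \<Rightarrow> 'a set \<Rightarrow> 'a set set" where
  "fam_link \<G> X = {A - X | A. A \<in> \<G> \<and> X \<subseteq> A}"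

definition fam_star :: "'a set set \<Rightarrow> 'a set \<Rightarrow> 'a set set" where
  "fam_star \<G> X = {A \<in> \<G>. X \<subseteq> A}"

definition fam_stars :: "'a set set \<Rightarrow> 'a set set \<Rightarrow> 'a set set" where
  "fam_stars \<G> \<S> = (\<Union>X\<in>\<S>. fam_star \<G> X)"

text \<open>Taken over a ground set \<open>E\<close>; used only for \<open>r > 1\<close>. The strict inequality forces
  \<open>\<G>\<close> to be nonempty as soon as \<open>E\<close> is.\<close>

definition spread_on :: "'a set \<Rightarrow> real \<Rightarrow> 'a set set \<Rightarrow> bool" where
  "spread_on E r \<G> \<longleftrightarrow>
     (\<forall>Y. Y \<subseteq> E \<and> Y \<noteq> {} \<longrightarrow>
        real (card (fam_link \<G> Y)) < r powr (- real (card Y)) * real (card \<G>))"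

text \<open>The maximum is over a nonempty finite set whenever \<open>t < n\<close>.\<close>

definition c_max :: "nat \<Rightarrow> nat \<Rightarrow> nat" where
  "c_max n t = Max {prod_list xs | xs. length xs = n - t \<and> (\<forall>x\<in>set xs. 0 < x) \<and> sum_list xs = n}"

end

theory Submission
  imports Defs "HOL-Library.FuncSet"
begin

text \<open>
  Put \<open>r = n powr (\<epsilon> / 2)\<close>. Repeatedly remove from \<open>\<F>\<close> the star of an inclusion-maximal set \<open>X\<close>
  with \<open>card \<F>(X) \<ge> r powr (- card X) * card \<F>\<close>; by maximality the link of the removed star at \<open>X\<close>
  is \<open>r\<close>-spread. Stop as soon as \<open>X\<close> has more than \<open>q'\<close> edges; the removed \<open>X\<close> form \<open>\<S>\<close> and the
  leftover is \<open>\<F>'\<close>.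

  A set \<open>Y\<close> of fewer than \<open>n\<close> edges meets some member of an \<open>r\<close>-spread family in at most \<open>n / r\<close>
  edges, by averaging. Used twice, this yields members of \<open>\<F>\<close> above \<open>A\<close> and \<open>B\<close> in \<open>\<S>\<close> that share at
  most \<open>card (A \<inter> B) + 2 * n / r\<close> edges; since \<open>2 * n / r < n powr (1 - \<epsilon> / 3)\<close>, the family \<open>\<S>\<close> is
  \<open>t'\<close>-intersecting.

  Orienting trees towards vertex 1 shows that at most \<open>2 ^ s * n ^ (n - 1 - s)\<close> trees contain a
  given set of \<open>s\<close> edges. As \<open>card \<F>'\<close> is at most \<open>r powr s\<close> times such a number with
  \<open>s > (1 + \<epsilon>) * t\<close>, and \<open>c_max n t \<ge> 1\<close>, the bound on \<open>\<F>'\<close> follows.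
\<close>

section \<open>Dense sets and the peeling procedure\<close>

lemma card_fam_link: "card (fam_link \<G> X) = card (fam_star \<G> X)"
proof -
  have "fam_link \<G> X = (\<lambda>A. A - X) ` fam_star \<G> X"
    by (auto simp: fam_link_def fam_star_def)
  moreover have "inj_on (\<lambda>A. A - X) (fam_star \<G> X)"
    by (auto simp: inj_on_def fam_star_def)
  ultimately show ?thesis by (simp add: card_image)
qed

lemma spread_on_imp_nonempty:
  assumes "spread_on E r \<G>" "E \<noteq> {}"
  shows "\<G> \<noteq> {}"
  using assms by (auto simp: spread_on_def fam_link_def)

text \<open>If \<open>Y\<close> disjoint from \<open>X\<close> violated spreadness of the link, then
  \<open>X \<union> Y\<close> would be dense in \<open>\<F>\<close>, because the weights
  \<open>r powr (- card)\<close> multiply over disjoint sets; this contradicts maximality. If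
  \<open>Y\<close> meets \<open>X\<close>, its link is empty.\<close>

lemma spread_on_fam_link_star:
  assumes fin: "finite \<F>" and finX: "finite X" and ne: "fam_star \<F> X \<noteq> {}" and r: "r > 0"
    and finE: "finite E"
    and dense: "real (card (fam_star \<F> X)) \<ge> r powr (- real (card X)) * real (card \<F>)"
    and maximal: "\<And>Y. X \<subset> Y \<Longrightarrow> finite Y \<Longrightarrow>
      real (card (fam_star \<F> Y)) < r powr (- real (card Y)) * real (card \<F>)"
  shows "spread_on E r (fam_link (fam_star \<F> X) X)"
  unfolding spread_on_def
proof (intro allI impI)
  fix Y assume Y: "Y \<subseteq> E \<and> Y \<noteq> {}"
  let ?G = "fam_link (fam_star \<F> X) X"
  have finY: "finite Y" using Y finE finite_subset by blast
  have idem: "fam_star (fam_star \<F> X) X = fam_star \<F> X" by (auto simp: fam_star_def)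
  have cG: "card ?G = card (fam_star \<F> X)" by (simp add: card_fam_link idem)
  have "finite (fam_star \<F> X)" using fin by (auto simp: fam_star_def)
  then have pos: "card ?G > 0" using ne cG card_gt_0_iff by metis
  show "real (card (fam_link ?G Y)) < r powr (- real (card Y)) * real (card ?G)"
  proof (cases "Y \<inter> X = {}")
    case False
    then have "fam_link ?G Y = {}" by (auto simp: fam_link_def)
    then show ?thesis using pos r by simp
  next
    case True
    have "Y \<subseteq> A - X \<longleftrightarrow> Y \<subseteq> A" for A using True by blast
    then have "fam_link ?G Y = {A - X - Y | A. A \<in> \<F> \<and> X \<subseteq> A \<and> Y \<subseteq> A}"
      unfolding fam_link_def fam_star_def by blast
    also have "\<dots> = fam_link \<F> (X \<union> Y)"
      unfolding fam_link_def by (simp add: Diff_eq Int_assoc)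
    finally have "real (card (fam_link ?G Y)) = real (card (fam_star \<F> (X \<union> Y)))"
      by (simp add: card_fam_link)
    also have "\<dots> < r powr (- real (card (X \<union> Y))) * real (card \<F>)"
      using Y True finX finY by (intro maximal) auto
    also have "\<dots> = r powr (- real (card Y)) * (r powr (- real (card X)) * real (card \<F>))"
      using True finX finY by (simp add: card_Un_disjoint Int_commute powr_add[symmetric] algebra_simps)
    also have "\<dots> \<le> r powr (- real (card Y)) * real (card ?G)"
      using dense cG by (intro mult_left_mono) auto
    finally show ?thesis .
  qed
qed

lemma exists_maximal_dense_set:
  fixes r :: real
  assumes fin: "finite \<F>" and finA: "\<And>A. A \<in> \<F> \<Longrightarrow> finite A" and ne: "\<F> \<noteq> {}" and r: "r > 0"
  obtains X where "finite X" "fam_star \<F> X \<noteq> {}"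
    "real (card (fam_star \<F> X)) \<ge> r powr (- real (card X)) * real (card \<F>)"
    "\<And>Y. X \<subset> Y \<Longrightarrow> finite Y \<Longrightarrow>
      real (card (fam_star \<F> Y)) < r powr (- real (card Y)) * real (card \<F>)"
proof -
  define D where "D = {X. finite X \<and>
    real (card (fam_star \<F> X)) \<ge> r powr (- real (card X)) * real (card \<F>)}"
  have cF: "card \<F> > 0" using ne fin by (simp add: card_gt_0_iff)
  have star_ne: "fam_star \<F> X \<noteq> {}" if "X \<in> D" for X
  proof
    assume "fam_star \<F> X = {}"
    then have "r powr (- real (card X)) * real (card \<F>) \<le> 0" using that by (simp add: D_def)
    moreover have "r powr (- real (card X)) * real (card \<F>) > 0" using r cF by simp
    ultimately show False by linarith
  qed
  \<comment> \<open>A dense set lies inside some member of \<open>\<F>\<close>, so there are only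
    finitely many of them.\<close>
  have "D \<subseteq> Pow (\<Union>\<F>)" using star_ne by (fastforce simp: fam_star_def)
  then have finD: "finite D" using fin finA by (meson finite_Pow_iff finite_Union finite_subset)
  have "{} \<in> D" using r by (simp add: D_def fam_star_def)
  then obtain X where X: "X \<in> D" "\<And>Y. Y \<in> D \<Longrightarrow> X \<subseteq> Y \<Longrightarrow> X = Y"
    using finite_has_maximal[OF finD] by blast
  show thesis
  proof (rule that[of X])
    fix Y assume "X \<subset> Y" "finite Y"
    then show "real (card (fam_star \<F> Y)) < r powr (- real (card Y)) * real (card \<F>)"
      using X(2)[of Y] by (force simp: D_def not_le[symmetric])
  qed (use X star_ne in \<open>auto simp: D_def\<close>)
qed

text \<open>Each round splits off a nonempty star, so induction over proper subfamilies applies.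
  Density is measured in the current remainder; hence the spread families are subfamilies of
  \<open>\<F>\<close> that need not be full stars, and the last alternative compares
  \<open>\<F>'\<close> with its own star at \<open>X\<close>.\<close>

lemma spread_approximation:
  fixes r q :: real
  assumes "finite \<F>" "\<forall>A\<in>\<F>. finite A" "r > 0" "finite E"
  shows "\<exists>\<S> \<F>'. \<F>' \<subseteq> \<F> \<and> \<F> - \<F>' \<subseteq> fam_stars \<F> \<S> \<and>
    (\<forall>B\<in>\<S>. real (card B) \<le> q \<and> fam_star \<F> B \<noteq> {} \<and>
       (\<exists>\<F>\<^sub>B \<subseteq> \<F>. spread_on E r (fam_link \<F>\<^sub>B B))) \<and>
    (\<F>' = {} \<or> (\<exists>X. q < real (card X) \<and> fam_star \<F>' X \<noteq> {} \<and>
       real (card \<F>') \<le> r powr real (card X) * real (card (fam_star \<F>' X))))"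
  using assms(1,2)
proof (induction \<F> rule: finite_psubset_induct)
  case (psubset \<F>)
  show ?case
  proof (cases "\<F> = {}")
    case True
    then show ?thesis by (intro exI[of _ "{}"]) auto
  next
    case False
    obtain X where X: "finite X" "fam_star \<F> X \<noteq> {}"
      "real (card (fam_star \<F> X)) \<ge> r powr (- real (card X)) * real (card \<F>)"
      "\<And>Y. X \<subset> Y \<Longrightarrow> finite Y \<Longrightarrow>
        real (card (fam_star \<F> Y)) < r powr (- real (card Y)) * real (card \<F>)"
      using exists_maximal_dense_set[OF psubset.hyps _ False assms(3)] psubset.prems by blast
    show ?thesis
    proof (cases "q < real (card X)")
      case True
      \<comment> \<open>Stopping case: all of the current family is leftover, and the density of
        \<open>X\<close> multiplied by \<open>r powr card X\<close> is the required bound.\<close>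
      have "real (card \<F>) = r powr real (card X) * (r powr (- real (card X)) * real (card \<F>))"
        using assms(3) by (simp add: powr_minus)
      also have "\<dots> \<le> r powr real (card X) * real (card (fam_star \<F> X))"
        using X(3) by (intro mult_left_mono) auto
      finally show ?thesis
        using True X(2) by (intro exI[of _ "{}"] exI[of _ \<F>]) auto
    next
      case small: False
      let ?G = "\<F> - fam_star \<F> X"
      have sub: "?G \<subset> \<F>" using X(2) by (auto simp: fam_star_def)
      obtain \<S> \<F>' where IH: "\<F>' \<subseteq> ?G" "?G - \<F>' \<subseteq> fam_stars ?G \<S>"
        "\<And>B. B \<in> \<S> \<Longrightarrow> real (card B) \<le> q \<and> fam_star ?G B \<noteq> {} \<and>
          (\<exists>\<F>\<^sub>B \<subseteq> ?G. spread_on E r (fam_link \<F>\<^sub>B B))"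
        "\<F>' = {} \<or> (\<exists>X. q < real (card X) \<and> fam_star \<F>' X \<noteq> {} \<and>
          real (card \<F>') \<le> r powr real (card X) * real (card (fam_star \<F>' X)))"
        using psubset.IH[OF sub] psubset.prems by (metis (no_types, lifting) DiffD1)
      have spr: "spread_on E r (fam_link (fam_star \<F> X) X)"
        using spread_on_fam_link_star[OF psubset.hyps X(1,2) assms(3,4) X(3,4)] by blast
      have "\<F> - \<F>' \<subseteq> fam_stars \<F> (insert X \<S>)"
        using IH(2) by (fastforce simp: fam_stars_def fam_star_def)
      moreover have "real (card B) \<le> q \<and> fam_star \<F> B \<noteq> {} \<and>
          (\<exists>\<F>\<^sub>B \<subseteq> \<F>. spread_on E r (fam_link \<F>\<^sub>B B))" if "B \<in> insert X \<S>" for B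
      proof (cases "B = X")
        case True
        moreover have "fam_star \<F> X \<subseteq> \<F>" by (auto simp: fam_star_def)
        ultimately show ?thesis using small X(2) spr by (simp add: not_less) blast
      next
        case False
        then have B: "B \<in> \<S>" using that by simp
        have "fam_star ?G B \<subseteq> fam_star \<F> B" by (auto simp: fam_star_def)
        then show ?thesis using IH(3)[OF B] by blast
      qed
      ultimately show ?thesis
        using IH(1,4) by (intro exI[of _ "insert X \<S>"] exI[of _ \<F>']) auto
    qed
  qed
qed

section \<open>Small intersections with spread families\<close>

text \<open>Double counting of pairs \<open>x \<in> C \<inter> X\<close>: spreadness at
  \<open>{x}\<close> says that each \<open>x\<close> lies in fewer than \<open>card \<G> / r\<close>
  members, so the average of \<open>card (C \<inter> X)\<close> is at most
  \<open>card X / r\<close>.\<close>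

lemma spread_on_exists_small_inter:
  assumes spread: "spread_on E r \<G>" and fin: "finite \<G>" and E: "E \<noteq> {}" and X: "X \<subseteq> E" "finite X"
    and r: "r > 0"
  shows "\<exists>C\<in>\<G>. real (card (C \<inter> X)) \<le> real (card X) / r"
proof (rule ccontr)
  assume "\<not> ?thesis"
  then have big: "real (card X) / r < real (card (C \<inter> X))" if "C \<in> \<G>" for C
    using that by force
  have ne: "\<G> \<noteq> {}" using spread_on_imp_nonempty[OF spread E] .
  have "real (card \<G>) * (real (card X) / r) = (\<Sum>C\<in>\<G>. real (card X) / r)" by simp
  also have "\<dots> < (\<Sum>C\<in>\<G>. real (card (C \<inter> X)))"
    using ne fin big by (intro sum_strict_mono) auto
  also have "\<dots> = (\<Sum>C\<in>\<G>. \<Sum>x\<in>X. if x \<in> C then 1 else 0)"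
    using X by (simp add: sum.If_cases Int_commute)
  also have "\<dots> = (\<Sum>x\<in>X. \<Sum>C\<in>\<G>. if x \<in> C then 1 else 0)" by (rule sum.swap)
  also have "\<dots> = (\<Sum>x\<in>X. real (card (fam_link \<G> {x})))"
  proof (rule sum.cong)
    fix x
    have "\<G> \<inter> {C. x \<in> C} = fam_star \<G> {x}" by (auto simp: fam_star_def)
    then show "(\<Sum>C\<in>\<G>. if x \<in> C then 1 else 0) = real (card (fam_link \<G> {x}))"
      using fin by (simp add: card_fam_link sum.If_cases)
  qed simp
  also have "\<dots> \<le> (\<Sum>x\<in>X. real (card \<G>) / r)"
  proof (rule sum_mono)
    fix x assume "x \<in> X"
    then have "real (card (fam_link \<G> {x})) < r powr (- real (card {x})) * real (card \<G>)"
      using spread X unfolding spread_on_def by blast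
    then show "real (card (fam_link \<G> {x})) \<le> real (card \<G>) / r"
      using r by (simp add: powr_minus divide_inverse mult.commute)
  qed
  finally show False by (simp add: mult.commute)
qed

section \<open>Trees as parent functions\<close>

text \<open>A shortest walk from \<open>u\<close> to \<open>v\<close> avoiding the edge
  \<open>{u, v}\<close> repeats no vertex, so this edge closes it to a cycle.\<close>

lemma no_cycle_imp_bridge:
  assumes acyc: "\<not> (\<exists>vs. graph_cycle E vs)" and e: "{u, v} \<in> E" "u \<noteq> v"
  shows "(u, v) \<notin> {(x, y). {x, y} \<in> E - {{u, v}}}\<^sup>*"
proof
  let ?R = "{(x, y). {x, y} \<in> E - {{u, v}}}"
  assume "(u, v) \<in> ?R\<^sup>*"
  then have ex: "\<exists>k. (u, v) \<in> ?R ^^ k" by (simp add: rtrancl_power)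
  define k where "k = (LEAST k. (u, v) \<in> ?R ^^ k)"
  have k: "(u, v) \<in> ?R ^^ k" unfolding k_def using ex by (rule LeastI_ex)
  have least: "k \<le> m" if "(u, v) \<in> ?R ^^ m" for m unfolding k_def using that by (rule Least_le)
  obtain f where f: "f 0 = u" "f k = v" "\<And>i. i < k \<Longrightarrow> (f i, f (Suc i)) \<in> ?R"
    using k unfolding relpow_fun_conv by blast
  have seg: "(f i, f (i + m)) \<in> ?R ^^ m" if "i + m \<le> k" for i m
    unfolding relpow_fun_conv using f(3) that by (intro exI[of _ "\<lambda>l. f (i + l)"]) auto
  have neq: "f i \<noteq> f j" if "i < j" "j \<le> k" for i j
  proof
    assume eq: "f i = f j"
    have "(u, f i) \<in> ?R ^^ i" using seg[of 0 i] that f by simp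
    moreover have "(f i, v) \<in> ?R ^^ (k - j)" using seg[of j "k - j"] that f eq by simp
    \<comment> \<open>Skipping the stretch between the equal vertices \<open>f i\<close> and
      \<open>f j\<close> gives a shorter walk.\<close>
    ultimately have "(u, v) \<in> ?R ^^ (i + (k - j))" by (auto simp: relpow_add)
    from least[OF this] that show False by linarith
  qed
  \<comment> \<open>\<open>k = 0\<close> would mean \<open>u = v\<close>, and \<open>k = 1\<close>
    would use the deleted edge; so the cycle has at least three vertices.\<close>
  have k2: "k \<ge> 2"
  proof (rule ccontr)
    assume "\<not> k \<ge> 2"
    then consider "k = 0" | "k = 1" by linarith
    then show False
    proof cases
      case 1 then show False using f(1,2) e by simp
    next
      case 2 then show False using f(3)[of 0] f(1,2) by simp
    qed
  qed
  let ?vs = "map f [0..<Suc k]"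
  have "graph_cycle E ?vs"
    unfolding graph_cycle_def
  proof (intro conjI allI impI)
    show "3 \<le> length ?vs" using k2 by simp
    show "distinct ?vs"
      unfolding distinct_map
    proof (intro conjI inj_onI distinct_upt)
      fix i j assume "i \<in> set [0..<Suc k]" "j \<in> set [0..<Suc k]" and eq: "f i = f j"
      then have "i \<le> k" "j \<le> k" by auto
      with neq[of i j] neq[of j i] eq show "i = j" by (cases i j rule: linorder_cases) auto
    qed
    fix i assume i: "i < length ?vs"
    show "{?vs ! i, ?vs ! (Suc i mod length ?vs)} \<in> E"
    \<comment> \<open>At \<open>i = k\<close> the successor index wraps to 0, and the pair is the
      closing edge \<open>{v, u}\<close>.\<close>
    proof (cases "i = k")
      case True
      then show ?thesis using f e by (simp add: insert_commute nth_append del: upt_Suc)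
    next
      case False
      then show ?thesis using f(3)[of i] i by (simp del: upt_Suc)
    qed
  qed
  then show False using acyc by blast
qed

text \<open>The parent of \<open>v\<close> is the next vertex on a shortest walk from
  \<open>v\<close> to 1. Parent edges alone connect every vertex to 1, so any further edge of
  \<open>T\<close> would fail to be a bridge.\<close>

lemma spanning_tree_parent_function:
  assumes T: "T \<in> spanning_trees n"
  obtains p where "p \<in> {2..n} \<rightarrow> {1..n}" "T = (\<lambda>v. {v, p v}) ` {2..n}"
proof -
  let ?R = "{(x, y). {x, y} \<in> T}"
  have TK: "T \<subseteq> Kn_edges n" and acyc: "\<not> (\<exists>vs. graph_cycle T vs)"
    and conn: "edges_connect T {1..n}"
    using T by (auto simp: spanning_trees_def Kn_forests_def)
  define d where "d v = (LEAST k. (v, 1) \<in> ?R ^^ k)" for v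
  have "\<exists>y. {v, y} \<in> T \<and> y \<in> {1..n} \<and> d y < d v" if v: "v \<in> {2..n}" for v
  proof -
    have "(v, 1) \<in> ?R\<^sup>*" using conn v by (auto simp: edges_connect_def)
    then have "\<exists>k. (v, 1) \<in> ?R ^^ k" by (simp add: rtrancl_power)
    then have dv: "(v, 1) \<in> ?R ^^ d v" unfolding d_def by (rule LeastI_ex)
    with v obtain m where m: "d v = Suc m" by (cases "d v") auto
    then obtain y where y: "{v, y} \<in> T" "(y, 1) \<in> ?R ^^ m"
      using relpow_Suc_D2[of v 1 m ?R] dv by auto
    have "d y \<le> m" unfolding d_def using y(2) by (rule Least_le)
    moreover have "y \<in> {1..n}" using y(1) TK by (auto simp: Kn_edges_def)
    ultimately show ?thesis using y(1) m by auto
  qed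
  then obtain p where p: "\<And>v. v \<in> {2..n} \<Longrightarrow> {v, p v} \<in> T \<and> p v \<in> {1..n} \<and> d (p v) < d v"
    by metis
  let ?P = "(\<lambda>v. {v, p v}) ` {2..n}"
  let ?Q = "{(x, y). {x, y} \<in> ?P}"
  have root: "(v, 1) \<in> ?Q\<^sup>*" if "v \<in> {1..n}" for v
    using that
  proof (induction "d v" arbitrary: v rule: less_induct)
    case less
    show ?case
    proof (cases "v = 1")
      case False
      then have v: "v \<in> {2..n}" using less.prems by auto
      then have "(v, p v) \<in> ?Q" by auto
      moreover have "(p v, 1) \<in> ?Q\<^sup>*" using p[OF v] less.hyps by blast
      ultimately show ?thesis by (rule converse_rtrancl_into_rtrancl)
    qed simp
  qed
  have "sym ?Q" by (auto simp: sym_def insert_commute)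
  then have symQ: "sym (?Q\<^sup>*)" by (rule sym_rtrancl)
  have "T \<subseteq> ?P"
  proof
    fix e assume e: "e \<in> T"
    then obtain u w where uw: "e = {u, w}" "u \<noteq> w" "u \<in> {1..n}" "w \<in> {1..n}"
      using TK by (auto simp: Kn_edges_def card_2_iff)
    show "e \<in> ?P"
    proof (rule ccontr)
      assume "e \<notin> ?P"
      \<comment> \<open>All parent edges survive the deletion of \<open>e\<close>, and its ends
        \<open>u\<close> and \<open>w\<close> are still joined through 1.\<close>
      then have "?Q \<subseteq> {(x, y). {x, y} \<in> T - {{u, w}}}" using p uw by auto
      moreover have "(u, w) \<in> ?Q\<^sup>*"
        using root[OF uw(3)] symD[OF symQ root[OF uw(4)]] by (rule rtrancl_trans)
      ultimately show False
        using no_cycle_imp_bridge[OF acyc, of u w] e uw rtrancl_mono by blast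
    qed
  qed
  then have "T = ?P" using p by auto
  then show thesis using p by (intro that[of p]) auto
qed

section \<open>Counting the trees that contain given edges\<close>

lemma finite_Kn_edges: "finite (Kn_edges n)"
  by (rule finite_subset[of _ "Pow {1..n}"]) (auto simp: Kn_edges_def)

lemma spanning_tree_subset_Kn_edges: "T \<in> spanning_trees n \<Longrightarrow> T \<subseteq> Kn_edges n"
  by (simp add: spanning_trees_def Kn_forests_def)

lemma finite_spanning_tree: "T \<in> spanning_trees n \<Longrightarrow> finite T"
  using spanning_tree_subset_Kn_edges finite_Kn_edges finite_subset by blast

lemma finite_spanning_trees: "finite (spanning_trees n)"
  by (rule finite_subset[of _ "Pow (Kn_edges n)"])
    (auto simp: finite_Kn_edges dest: spanning_tree_subset_Kn_edges)

lemma card_spanning_tree_le: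
  assumes "T \<in> spanning_trees n"
  shows "card T \<le> n - 1"
proof -
  obtain p where "T = (\<lambda>v. {v, p v}) ` {2..n}"
    using spanning_tree_parent_function[OF assms] by metis
  then show ?thesis using card_image_le[of "{2..n}" "\<lambda>v. {v, p v}"] by simp
qed

lemma Kn_forests_subset: "A \<in> Kn_forests n \<Longrightarrow> B \<subseteq> A \<Longrightarrow> B \<in> Kn_forests n"
  unfolding Kn_forests_def graph_cycle_def by blast

text \<open>A tree containing \<open>S\<close> is encoded by the lower endpoint of each edge of \<open>S\<close> when the tree is
  rooted at 1, together with the parents of the remaining vertices.\<close>

lemma card_spanning_trees_containing_le:
  assumes S: "S \<subseteq> Kn_edges n"
  shows "card (fam_star (spanning_trees n) S) \<le> 2 ^ card S * n ^ (n - 1 - card S)"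
proof -
  have finS: "finite S" using S finite_Kn_edges finite_subset by blast
  have fin_edge: "finite e" "card e = 2" if "e \<in> S" for e
    using S that by (auto simp: Kn_edges_def intro: finite_subset)
  \<comment> \<open>\<open>g\<close> picks the lower endpoint of each edge of \<open>S\<close>;
    \<open>\<Phi> g\<close> extends \<open>S\<close> by an arbitrary parent for each vertex of
    \<open>{2..n}\<close> not picked. The resulting edge sets need not be trees, which is harmless
    for an upper bound.\<close>
  define G where "G = {g \<in> S \<rightarrow>\<^sub>E \<Union>S. (\<forall>e\<in>S. g e \<in> e) \<and> inj_on g S \<and> g ` S \<subseteq> {2..n}}"
  define \<Phi> where
    "\<Phi> g = (\<lambda>h. S \<union> (\<lambda>v. {v, h v}) ` ({2..n} - g ` S)) ` (({2..n} - g ` S) \<rightarrow>\<^sub>E {1..n})" for g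
  have finPi: "finite (PiE S (\<lambda>e. e))" using finS fin_edge by (intro finite_PiE) auto
  have Gsub: "G \<subseteq> PiE S (\<lambda>e. e)" by (auto simp: G_def PiE_def Pi_def)
  have finG: "finite G" using finPi Gsub finite_subset by blast
  have "card G \<le> card (PiE S (\<lambda>e. e))" using card_mono[OF finPi Gsub] .
  also have "\<dots> = 2 ^ card S" using finS fin_edge by (simp add: card_PiE)
  finally have cG: "card G \<le> 2 ^ card S" .
  have fin\<Phi>: "finite (\<Phi> g)" for g unfolding \<Phi>_def by (intro finite_imageI finite_PiE) auto
  have c\<Phi>: "card (\<Phi> g) \<le> n ^ (n - 1 - card S)" if "g \<in> G" for g
  proof -
    \<comment> \<open>\<open>{2..n}\<close> has \<open>n - 1\<close> elements, and the injective
      \<open>g\<close> uses up \<open>card S\<close> of them.\<close>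
    have "card ({2..n} - g ` S) = n - 1 - card S"
      using that finS by (auto simp: G_def card_Diff_subset card_image)
    then have "card (({2..n} - g ` S) \<rightarrow>\<^sub>E {1..n}) = n ^ (n - 1 - card S)"
      by (simp add: card_PiE)
    moreover have "finite (({2..n} - g ` S) \<rightarrow>\<^sub>E {1..n})" by (intro finite_PiE) auto
    then have "card (\<Phi> g) \<le> card (({2..n} - g ` S) \<rightarrow>\<^sub>E {1..n})"
      unfolding \<Phi>_def by (rule card_image_le)
    ultimately show ?thesis by simp
  qed
  have "fam_star (spanning_trees n) S \<subseteq> (\<Union>g\<in>G. \<Phi> g)"
  proof
    fix T assume "T \<in> fam_star (spanning_trees n) S"
    then have T: "T \<in> spanning_trees n" "S \<subseteq> T" by (auto simp: fam_star_def)
    obtain p where p: "p \<in> {2..n} \<rightarrow> {1..n}" "T = (\<lambda>v. {v, p v}) ` {2..n}"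
      using spanning_tree_parent_function[OF T(1)] by metis
    then have "\<forall>e\<in>S. \<exists>v. v \<in> {2..n} \<and> e = {v, p v}" using T(2) by blast
    then obtain g0 where g0: "\<And>e. e \<in> S \<Longrightarrow> g0 e \<in> {2..n} \<and> e = {g0 e, p (g0 e)}" by metis
    define g where "g = restrict g0 S"
    have g: "g e \<in> {2..n}" "{g e, p (g e)} = e" if "e \<in> S" for e
      using g0[OF that] that by (auto simp: g_def)
    have g_in: "g e \<in> e" if "e \<in> S" for e using g(2)[OF that] by blast
    \<comment> \<open>An edge is recovered from its lower endpoint \<open>v\<close> as
      \<open>{v, p v}\<close>.\<close>
    have "inj_on g S" using g(2) by (metis inj_onI)
    then have gG: "g \<in> G" using g(1) g_in by (auto simp: G_def g_def)
    let ?W = "{2..n} - g ` S"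
    have img: "(\<lambda>v. {v, p v}) ` g ` S = S" using g(2) by (force simp: image_image)
    have "{2..n} = g ` S \<union> ?W" using g(1) by auto
    then have "T = (\<lambda>v. {v, p v}) ` g ` S \<union> (\<lambda>v. {v, p v}) ` ?W"
      using p(2) by (metis image_Un)
    also have "\<dots> = S \<union> (\<lambda>v. {v, restrict p ?W v}) ` ?W" unfolding img by auto
    finally have "T \<in> \<Phi> g"
      using p(1) unfolding \<Phi>_def by (intro image_eqI[where x = "restrict p ?W"]) auto
    then show "T \<in> (\<Union>g\<in>G. \<Phi> g)" using gG by blast
  qed
  then have "card (fam_star (spanning_trees n) S) \<le> card (\<Union>g\<in>G. \<Phi> g)"
    using finG fin\<Phi> by (intro card_mono) auto
  also have "\<dots> \<le> (\<Sum>g\<in>G. card (\<Phi> g))" using finG by (rule card_UN_le)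
  also have "\<dots> \<le> card G * n ^ (n - 1 - card S)"
    using sum_bounded_above[of G "\<lambda>g. card (\<Phi> g)"] c\<Phi> by simp
  also have "\<dots> \<le> 2 ^ card S * n ^ (n - 1 - card S)" using cG by simp
  finally show ?thesis .
qed

section \<open>Numerical bound for the leftover\<close>

text \<open>Allows the factor \<open>c_max n t\<close> to be inserted into the leftover bound. The
  witness is the composition of \<open>n\<close> into \<open>t + 1\<close> and
  \<open>n - t - 1\<close> ones.\<close>

lemma c_max_ge_1:
  assumes "t < n"
  shows "c_max n t \<ge> 1"
proof -
  let ?M = "{prod_list xs | xs. length xs = n - t \<and> (\<forall>x\<in>set xs. 0 < x) \<and> sum_list xs = n}"
  let ?L = "{xs. set xs \<subseteq> {..n} \<and> length xs = n - t}"
  have "?M \<subseteq> prod_list ` ?L" by (auto intro!: imageI member_le_sum_list)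
  then have fin: "finite ?M"
    using finite_lists_length_eq[of "{..n}" "n - t"] finite_subset by blast
  let ?xs = "Suc t # replicate (n - t - 1) 1"
  have "prod_list ?xs \<in> ?M"
    using assms by (intro CollectI exI[of _ ?xs]) (auto simp: sum_list_replicate)
  then have "prod_list ?xs \<le> c_max n t" unfolding c_max_def using fin by (rule Max_ge[rotated])
  then show ?thesis by (simp add: prod_list_replicate)
qed

text \<open>Comparison of exponents of \<open>n\<close>. With \<open>2 ^ s\<close> absorbed into
  \<open>n powr (\<epsilon> / 48 * s)\<close>, each of the \<open>s\<close> edges saves
  \<open>1 - \<epsilon> * 25 / 48\<close>, where \<open>25 / 48 = 1 / 2 + 1 / 48\<close>. The total
  must reach \<open>t + \<epsilon> * t / 3 + 1\<close>; the final 1 is the gap between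
  \<open>n - 1\<close> and \<open>n - 2\<close>.\<close>

lemma leftover_bound:
  fixes \<epsilon> :: real and n t s :: nat
  assumes \<epsilon>: "0 < \<epsilon>" "\<epsilon> < 1 / 6" and n: "2 \<le> real n powr (\<epsilon> / 48)" "n > 1"
    and t: "48 / \<epsilon> \<le> real t" "t + 2 \<le> n"
    and s: "(1 + \<epsilon>) * real t \<le> real s" "s \<le> n - 1"
  shows "(real n powr (\<epsilon> / 2)) powr real s * (2 ^ s * real n ^ (n - 1 - s))
    \<le> real n powr (- (1 / 3) * \<epsilon> * real t) * real n ^ (n - t - 2)"
proof -
  have n0: "real n > 0" using n by simp
  have "(2::real) ^ s \<le> (real n powr (\<epsilon> / 48)) ^ s" using n by (intro power_mono) auto
  also have "\<dots> = real n powr (\<epsilon> / 48 * real s)" using n0 by (simp add: powr_powr flip: powr_realpow)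
  finally have two: "(2::real) ^ s \<le> real n powr (\<epsilon> / 48 * real s)" .
  have one: "1 \<le> \<epsilon> * real t / 48" using t \<epsilon> by (simp add: field_simps)
  have "(1 + \<epsilon>) * real t * (1 - \<epsilon> * 25 / 48) \<le> real s * (1 - \<epsilon> * 25 / 48)"
    using s \<epsilon> by (intro mult_right_mono) auto
  moreover have "(1 + \<epsilon>) * real t * (1 - \<epsilon> * 25 / 48)
      = real t + \<epsilon> * real t * 23 / 48 - \<epsilon> * (\<epsilon> * real t) * 25 / 48" by (simp add: field_simps)
  moreover have "\<epsilon> * (\<epsilon> * real t) \<le> 1 / 6 * (\<epsilon> * real t)" using \<epsilon> by (intro mult_right_mono) auto
  moreover have "0 \<le> \<epsilon> * real t" using \<epsilon> by simp
  \<comment> \<open>For \<open>\<epsilon> < 1 / 6\<close> the saving is at least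
    \<open>t + 113 / 288 * \<epsilon> * t\<close>. Since \<open>1 / 3 = 96 / 288\<close>, a surplus
    of \<open>17 / 288 * \<epsilon> * t\<close> remains, which exceeds
    \<open>\<epsilon> * t / 48 \<ge> 1\<close>.\<close>
  ultimately have main: "real t + \<epsilon> * real t / 3 + 1 \<le> real s * (1 - \<epsilon> * 25 / 48)"
    using one by linarith
  have "(real n powr (\<epsilon> / 2)) powr real s * (2 ^ s * real n ^ (n - 1 - s))
      \<le> (real n powr (\<epsilon> / 2)) powr real s
        * (real n powr (\<epsilon> / 48 * real s) * real n ^ (n - 1 - s))"
    using two by (intro mult_left_mono mult_right_mono) auto
  also have "\<dots> = real n powr (\<epsilon> / 2 * real s + \<epsilon> / 48 * real s + (real n - 1 - real s))"
  proof -
    have "real (n - 1 - s) = real n - 1 - real s" using s n by simp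
    then have "real n ^ (n - 1 - s) = real n powr (real n - 1 - real s)"
      using n0 by (metis powr_realpow)
    then show ?thesis unfolding powr_powr powr_add by simp
  qed
  also have "\<dots> \<le> real n powr (- (1 / 3) * \<epsilon> * real t + (real n - real t - 2))"
  proof (rule powr_mono)
    have "real s * (1 - \<epsilon> * 25 / 48) = real s - \<epsilon> / 2 * real s - \<epsilon> / 48 * real s"
      by (simp add: algebra_simps)
    then show "\<epsilon> / 2 * real s + \<epsilon> / 48 * real s + (real n - 1 - real s)
        \<le> - (1 / 3) * \<epsilon> * real t + (real n - real t - 2)" using main by linarith
  qed (use n in simp)
  also have "\<dots> = real n powr (- (1 / 3) * \<epsilon> * real t) * real n ^ (n - t - 2)"
  proof -
    have "real (n - t - 2) = real n - real t - 2" using t by simp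
    then have "real n ^ (n - t - 2) = real n powr (real n - real t - 2)"
      using n0 by (metis powr_realpow)
    then show ?thesis unfolding powr_add by simp
  qed
  finally show ?thesis .
qed

section \<open>Intersections of the bases\<close>

text \<open>Members of \<open>\<F>\<close> above two bases can be chosen to share at most
  \<open>2 * m / r\<close> elements outside the common part of the bases, yet they share at least
  \<open>t\<close> in all.\<close>

lemma intersecting_spread_bases:
  fixes \<F> \<S> :: "'a set set"
  assumes int: "intersecting t \<F>" and finF: "finite \<F>" and E: "finite E" "E \<noteq> {}" and r: "r > 0"
    and mem: "\<And>A. A \<in> \<F> \<Longrightarrow> A \<subseteq> E \<and> real (card A) \<le> m"
    and bases: "\<And>B. B \<in> \<S> \<Longrightarrow> fam_star \<F> B \<noteq> {} \<and>
      (\<exists>\<F>\<^sub>B \<subseteq> \<F>. spread_on E r (fam_link \<F>\<^sub>B B))"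
  shows "intersecting (t - 2 * m / r) \<S>"
  unfolding intersecting_def
proof (intro ballI)
  have avoid: "\<exists>A\<in>\<F>. B \<subseteq> A \<and> real (card ((A - B) \<inter> X)) \<le> m / r"
    if B: "B \<in> \<S>" and X: "X \<subseteq> E" "real (card X) \<le> m" for B X
  proof -
    obtain \<F>\<^sub>B where FB: "\<F>\<^sub>B \<subseteq> \<F>" "spread_on E r (fam_link \<F>\<^sub>B B)" using bases[OF B] by blast
    have "fam_link \<F>\<^sub>B B \<subseteq> (\<lambda>A. A - B) ` \<F>" using FB by (auto simp: fam_link_def)
    then have "finite (fam_link \<F>\<^sub>B B)" using finF finite_subset by blast
    then obtain C where C: "C \<in> fam_link \<F>\<^sub>B B" "real (card (C \<inter> X)) \<le> real (card X) / r"
      using spread_on_exists_small_inter[OF FB(2) _ E(2) X(1) _ r] X(1) E(1) finite_subset by blast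
    have "real (card X) / r \<le> m / r" using X r by (simp add: divide_right_mono)
    then show ?thesis using C FB(1) by (auto simp: fam_link_def)
  qed
  fix B1 B2 assume B: "B1 \<in> \<S>" "B2 \<in> \<S>"
  obtain A0 where A0: "A0 \<in> \<F>" "B1 \<subseteq> A0" using bases[OF B(1)] by (auto simp: fam_star_def)
  have finA: "finite A" if "A \<in> \<F>" for A using mem[OF that] E(1) finite_subset by blast
  have "card B1 \<le> card A0" using A0 finA by (intro card_mono) auto
  then have B1: "B1 \<subseteq> E" "real (card B1) \<le> m" using mem[OF A0(1)] A0(2) by auto
  \<comment> \<open>The choices are sequential: \<open>A2\<close> only has to avoid the base
    \<open>B1\<close>, after which \<open>A1\<close> avoids the whole of \<open>A2\<close>.\<close>
  obtain A2 where A2: "A2 \<in> \<F>" "B2 \<subseteq> A2" "real (card ((A2 - B2) \<inter> B1)) \<le> m / r"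
    using avoid[OF B(2) B1] by blast
  obtain A1 where A1: "A1 \<in> \<F>" "B1 \<subseteq> A1" "real (card ((A1 - B1) \<inter> A2)) \<le> m / r"
    using avoid[OF B(1), of A2] mem[OF A2(1)] by blast
  have fins: "finite A1" "finite A2" "finite B1" using finA A1 A2 A0 finite_subset by blast+
  \<comment> \<open>A common element outside \<open>B1\<close> lies in the last part; one inside
    \<open>B1\<close> is sorted by membership in \<open>B2\<close>.\<close>
  have "card (A1 \<inter> A2) \<le> card ((B1 \<inter> B2) \<union> ((A2 - B2) \<inter> B1) \<union> ((A1 - B1) \<inter> A2))"
    using fins by (intro card_mono) auto
  also have "\<dots> \<le> card (B1 \<inter> B2) + card ((A2 - B2) \<inter> B1) + card ((A1 - B1) \<inter> A2)"
    by (meson add_le_mono card_Un_le le_refl le_trans)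
  finally have "real (card (A1 \<inter> A2))
      \<le> real (card (B1 \<inter> B2)) + real (card ((A2 - B2) \<inter> B1)) + real (card ((A1 - B1) \<inter> A2))"
    by linarith
  moreover have "t \<le> real (card (A1 \<inter> A2))" using int A1(1) A2(1) by (auto simp: intersecting_def)
  moreover have "2 * m / r = m / r + m / r" by simp
  ultimately show "t - 2 * m / r \<le> real (card (B1 \<inter> B2))" using A1(3) A2(3) by linarith
qed

section \<open>Assembly for spanning trees and large \<open>n\<close>\<close>

text \<open>Two explicit conditions express that \<open>n\<close> is large: the first absorbs the
  factors 2 in the tree count and in \<open>2 * n / r\<close>, the second forces
  \<open>48 / \<epsilon> \<le> t\<close>.\<close>

lemma spread_approximation_spanning_trees:
  fixes \<epsilon> :: real and n t :: nat
  assumes \<epsilon>: "0 < \<epsilon>" "\<epsilon> < 1 / 6"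
    and n: "2 \<le> real n powr (\<epsilon> / 48)" "48 / \<epsilon> \<le> real n powr (1 - \<epsilon> / 3)"
    and t: "real n powr (1 - \<epsilon> / 3) \<le> real t" "t + 2 \<le> n"
    and F: "\<F> \<subseteq> spanning_trees n" "intersecting (real t) \<F>"
  shows "\<exists>\<S> \<F>'. \<S> \<subseteq> Kn_forests n \<and> intersecting (real t - real n powr (1 - \<epsilon> / 3)) \<S> \<and>
    (\<forall>B\<in>\<S>. real (card B) \<le> min ((1 + \<epsilon>) * real t) (real n - 1)) \<and>
    \<F>' \<subseteq> Pow (Kn_edges n) \<and> \<F> - \<F>' \<subseteq> fam_stars (spanning_trees n) \<S> \<and>
    (\<forall>B\<in>\<S>. \<exists>\<F>\<^sub>B. \<F>\<^sub>B \<subseteq> \<F> \<and>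
      spread_on (Kn_edges n) (real n powr (\<epsilon> / 2)) (fam_link \<F>\<^sub>B B)) \<and>
    real (card \<F>') \<le> real n powr (- (1 / 3) * \<epsilon> * real t) * real (c_max n t)
      * real n ^ (n - t - 2)"
proof -
  let ?q = "min ((1 + \<epsilon>) * real t) (real n - 1)" and ?r = "real n powr (\<epsilon> / 2)"
  have n1: "n > 1" using t by simp
  have r: "?r > 0" using n1 by simp
  have finF: "finite \<F>" using F(1) finite_spanning_trees finite_subset by blast
  have Kne: "Kn_edges n \<noteq> {}"
  proof -
    have "{1, 2} \<in> Kn_edges n" using n1 by (simp add: Kn_edges_def)
    then show ?thesis by blast
  qed
  have finA: "\<forall>A\<in>\<F>. finite A" using F(1) finite_spanning_tree by blast
  obtain \<S> \<F>' where SF: "\<F>' \<subseteq> \<F>" "\<F> - \<F>' \<subseteq> fam_stars \<F> \<S>"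
    "\<forall>B\<in>\<S>. real (card B) \<le> ?q \<and> fam_star \<F> B \<noteq> {} \<and>
       (\<exists>\<F>\<^sub>B \<subseteq> \<F>. spread_on (Kn_edges n) ?r (fam_link \<F>\<^sub>B B))"
    "\<F>' = {} \<or> (\<exists>X. ?q < real (card X) \<and> fam_star \<F>' X \<noteq> {} \<and>
       real (card \<F>') \<le> ?r powr real (card X) * real (card (fam_star \<F>' X)))"
    using spread_approximation[OF finF finA r finite_Kn_edges[of n], of ?q]
    by (elim exE conjE) (rule that)
  have "\<S> \<subseteq> Kn_forests n"
  proof
    fix B assume "B \<in> \<S>"
    then obtain A where "A \<in> \<F>" "B \<subseteq> A" using SF(3) by (fastforce simp: fam_star_def)
    then show "B \<in> Kn_forests n"
      using F(1) Kn_forests_subset by (auto simp: spanning_trees_def)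
  qed
  moreover have "intersecting (real t - real n powr (1 - \<epsilon> / 3)) \<S>"
  proof -
    have "intersecting (real t - 2 * real n / ?r) \<S>"
    proof (rule intersecting_spread_bases[OF F(2) finF finite_Kn_edges Kne r])
      fix A assume "A \<in> \<F>"
      then have "A \<in> spanning_trees n" using F(1) by blast
      then show "A \<subseteq> Kn_edges n \<and> real (card A) \<le> real n"
        using spanning_tree_subset_Kn_edges card_spanning_tree_le[of A n] by simp
    qed (use SF(3) in blast)
    moreover have "2 * real n / ?r \<le> real n powr (1 - \<epsilon> / 3)"
    proof -
      \<comment> \<open>The exponents compare as \<open>1 + \<epsilon> / 48 \<le> 1 - \<epsilon> / 3
        + \<epsilon> / 2 = 1 + \<epsilon> / 6\<close>.\<close>
      have "2 * real n \<le> real n powr (\<epsilon> / 48) * real n powr 1"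
        using n(1) n1 by simp
      also have "\<dots> \<le> real n powr (1 - \<epsilon> / 3) * ?r"
        unfolding powr_add[symmetric] using n1 \<epsilon> by (intro powr_mono) auto
      finally show ?thesis using r by (simp add: divide_le_eq)
    qed
    ultimately show ?thesis unfolding intersecting_def by fastforce
  qed
  moreover have "\<F>' \<subseteq> Pow (Kn_edges n)"
    using SF(1) F(1) spanning_tree_subset_Kn_edges by blast
  moreover have "\<F> - \<F>' \<subseteq> fam_stars (spanning_trees n) \<S>"
  proof -
    have "fam_stars \<F> \<S> \<subseteq> fam_stars (spanning_trees n) \<S>"
      unfolding fam_stars_def fam_star_def using F(1) by blast
    with SF(2) show ?thesis by (rule subset_trans)
  qed
  moreover have "real (card \<F>') \<le> real n powr (- (1 / 3) * \<epsilon> * real t) * real (c_max n t)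
      * real n ^ (n - t - 2)"
  proof (cases "\<F>' = {}")
    case False
    then obtain X where X: "?q < real (card X)" "fam_star \<F>' X \<noteq> {}"
      "real (card \<F>') \<le> ?r powr real (card X) * real (card (fam_star \<F>' X))" using SF(4) by blast
    then obtain T where T: "T \<in> spanning_trees n" "X \<subseteq> T"
      using SF(1) F(1) by (auto simp: fam_star_def)
    have "card X \<le> card T" using T finite_spanning_tree by (intro card_mono) auto
    then have Xn: "card X \<le> n - 1" using card_spanning_tree_le[OF T(1)] by linarith
    \<comment> \<open>As \<open>card X \<le> n - 1\<close>, exceeding the minimum means exceeding
      \<open>(1 + \<epsilon>) * t\<close>.\<close>
    then have Xt: "(1 + \<epsilon>) * real t \<le> real (card X)"
      using X(1) n1 by (auto simp: min_def split: if_splits)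
    have "card (fam_star \<F>' X) \<le> card (fam_star (spanning_trees n) X)"
      using SF(1) F(1) finite_spanning_trees by (intro card_mono) (auto simp: fam_star_def)
    also have "\<dots> \<le> 2 ^ card X * n ^ (n - 1 - card X)"
      using T spanning_tree_subset_Kn_edges by (intro card_spanning_trees_containing_le) blast
    finally have "real (card (fam_star \<F>' X)) \<le> real (2 ^ card X * n ^ (n - 1 - card X))"
      by (rule of_nat_mono)
    then have "?r powr real (card X) * real (card (fam_star \<F>' X))
        \<le> ?r powr real (card X) * (2 ^ card X * real n ^ (n - 1 - card X))"
      by (intro mult_left_mono) auto
    with X(3) have "real (card \<F>')
        \<le> ?r powr real (card X) * (2 ^ card X * real n ^ (n - 1 - card X))"
      by (rule order_trans)
    also have "\<dots> \<le> real n powr (- (1 / 3) * \<epsilon> * real t) * real n ^ (n - t - 2)"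
      using n t n1 Xt Xn by (intro leftover_bound[OF \<epsilon>]) auto
    also have "\<dots> \<le> real n powr (- (1 / 3) * \<epsilon> * real t) * real (c_max n t) * real n ^ (n - t - 2)"
      using c_max_ge_1[of t n] t by (intro mult_right_mono) (auto simp: mult_le_cancel_left1)
    finally show ?thesis .
  qed simp
  ultimately show ?thesis using SF(3) by (intro exI[of _ \<S>] exI[of _ \<F>'] conjI) blast+
qed

lemma powr_nat_eventually_ge:
  fixes a c :: real
  assumes "a > 0"
  shows "\<exists>N. \<forall>n>N. c \<le> real n powr a"
proof -
  \<comment> \<open>\<open>max 1 c\<close> keeps the base positive, so that the powers
    \<open>1 / a\<close> and \<open>a\<close> cancel.\<close>
  obtain N :: nat where N: "(max 1 c) powr (1 / a) < real N" using reals_Archimedean2 by blast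
  have "c \<le> real n powr a" if "n > N" for n
  proof -
    have "c \<le> ((max 1 c) powr (1 / a)) powr a" using assms by (simp add: powr_powr)
    also have "\<dots> \<le> real n powr a" using N that assms by (intro powr_mono2) auto
    finally show ?thesis .
  qed
  then show ?thesis by blast
qed

theorem theorem14:
  shows "\<exists>\<epsilon>\<^sub>0::real. 0 < \<epsilon>\<^sub>0 \<and>
    (\<forall>\<epsilon>::real. 0 < \<epsilon> \<and> \<epsilon> < \<epsilon>\<^sub>0 \<longrightarrow>
      (\<exists>n\<^sub>0::nat. \<forall>n::nat. n\<^sub>0 < n \<longrightarrow>
        (\<forall>(t::nat) \<F>. 1 \<le> t \<and> real n powr (1 - \<epsilon> / 3) \<le> real t \<and> t + 2 \<le> n \<and>
            \<F> \<subseteq> spanning_trees n \<and> intersecting (real t) \<F> \<longrightarrow>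
          (let t' = real t - real n powr (1 - \<epsilon> / 3);
               q' = min ((1 + \<epsilon>) * real t) (real n - 1)
           in \<exists>\<S> \<F>'.
               \<S> \<subseteq> Kn_forests n \<and> intersecting t' \<S> \<and> (\<forall>B\<in>\<S>. real (card B) \<le> q') \<and>
               \<F>' \<subseteq> Pow (Kn_edges n) \<and>
               \<F> - \<F>' \<subseteq> fam_stars (spanning_trees n) \<S> \<and>
               (\<forall>B\<in>\<S>. \<exists>\<F>\<^sub>B. \<F>\<^sub>B \<subseteq> \<F> \<and>
                  spread_on (Kn_edges n) (real n powr (\<epsilon> / 2)) (fam_link \<F>\<^sub>B B)) \<and>
               real (card \<F>') \<le> real n powr (- (1 / 3) * \<epsilon> * real t) * real (c_max n t)
                  * real n ^ (n - t - 2)))))"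
\<comment> \<open>The threshold \<open>1 / 6\<close> is the range of \<open>\<epsilon>\<close> in
  which the exponent comparison for the leftover was carried out.\<close>
proof (rule exI[of _ "1 / 6"], intro conjI allI impI)
  fix \<epsilon> :: real assume "0 < \<epsilon> \<and> \<epsilon> < 1 / 6"
  then have \<epsilon>: "0 < \<epsilon>" "\<epsilon> < 1 / 6" by auto
  obtain N1 where N1: "\<And>n. n > N1 \<Longrightarrow> 2 \<le> real n powr (\<epsilon> / 48)"
    using powr_nat_eventually_ge[of "\<epsilon> / 48" 2] \<epsilon> by auto
  obtain N2 where N2: "\<And>n. n > N2 \<Longrightarrow> 48 / \<epsilon> \<le> real n powr (1 - \<epsilon> / 3)"
    using powr_nat_eventually_ge[of "1 - \<epsilon> / 3" "48 / \<epsilon>"] \<epsilon> by auto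
  show "\<exists>n\<^sub>0::nat. \<forall>n::nat. n\<^sub>0 < n \<longrightarrow>
        (\<forall>(t::nat) \<F>. 1 \<le> t \<and> real n powr (1 - \<epsilon> / 3) \<le> real t \<and> t + 2 \<le> n \<and>
            \<F> \<subseteq> spanning_trees n \<and> intersecting (real t) \<F> \<longrightarrow>
          (let t' = real t - real n powr (1 - \<epsilon> / 3);
               q' = min ((1 + \<epsilon>) * real t) (real n - 1)
           in \<exists>\<S> \<F>'.
               \<S> \<subseteq> Kn_forests n \<and> intersecting t' \<S> \<and> (\<forall>B\<in>\<S>. real (card B) \<le> q') \<and>
               \<F>' \<subseteq> Pow (Kn_edges n) \<and>
               \<F> - \<F>' \<subseteq> fam_stars (spanning_trees n) \<S> \<and>
               (\<forall>B\<in>\<S>. \<exists>\<F>\<^sub>B. \<F>\<^sub>B \<subseteq> \<F> \<and>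
                  spread_on (Kn_edges n) (real n powr (\<epsilon> / 2)) (fam_link \<F>\<^sub>B B)) \<and>
               real (card \<F>') \<le> real n powr (- (1 / 3) * \<epsilon> * real t) * real (c_max n t)
                  * real n ^ (n - t - 2)))"
    unfolding Let_def using spread_approximation_spanning_trees[OF \<epsilon>] N1 N2
    by (intro exI[of _ "max N1 N2"] allI impI) (elim conjE, simp)
qed simp

end
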